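(* Let $h,m\in\mathbb{N}$ with $m\le h$ and $\tilde h=\lceil h/m\rceil$. A periodic sampling schedule with rational average sampling interval $h/m$ guarantees the smallest attenuation bound ($h_\infty$ norm) achievable among schedules with average sampling interval $h/m$ if its largest interval does not exceed $\tilde h$. Moreover, if $$\gamma_{\tilde h-1}<\gamma_{\tilde h}<\gamma_{\tilde h+1}$$ (where the first inequality is dropped when $\tilde h=1$), the schedules satisfying this property are the only schedules with average sampling interval $h/m$ that guarantee the smallest attenuation bound. Furthermore, under the same condition, the periodic schedule with the smallest average rate that guarantees this attenuation bound is evenly spaced sampling.
   Context: System: $x_{t+1}=Ax_t+Bu_t+w_t$, $t\in\mathbb{N}_0$, with output $z_t=C_2x_t+D_{21}u_t$, where $x_t,w_t\in\mathbb{R}^{n_x}$, $u_t\in\mathbb{R}^{n_u}$, $C_2^\top D_{21}=0$, $Q:=C_2^\top C_2$, $R:=D_{21}^\top D_{21}>0$, $(A,B)$ controllable and $(A,C_2)$ observable. Schedule: a tuple $\mathcal{T}=(\tau_0,\dots,\tau_{j-1})$ of positive integers is extended periodically by $\tau_{\ell+j}=\tau_\ell$; the sampling times are $s_0=0$, $s_{\ell+1}=s_\ell+\tau_\ell$; $\sigma_t=1$ if $t$ is a sampling time and $\sigma_t=0$ otherwise. The average sampling interval is $\frac1j\sum_{\ell=0}^{j-1}\tau_\ell$ and the average rate is its reciprocal. At time $t$ the controller knows $\mathcal{J}_t=\{x_r: 0\le r\le t,\ \sigma_r=1\}$, and a control policy $\pi_u$ is a sequence of functions $\mu_{u,t}$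 with $u_t=\mu_{u,t}(\mathcal{J}_t)$. Evenly spaced sampling with interval $h$ is the schedule with all intervals equal to $h$. $h_\infty$ norm: for sequences, $\|w\|^2=\sum_{t\ge0}w_t^\top w_t$, and $\ell_2$ is the space of sequences with finite norm. An attenuation bound $\gamma>0$ is achieved by $\pi_u$ if, with $x_0=0$, $\|z\|^2\le\gamma^2\|w\|^2$ for all $w\in\ell_2$. Then $\gamma_{\mathcal{T}}:=\inf\{\gamma:\ \text{there is } \pi_u \text{ achieving the attenuation bound } \gamma \text{ under schedule } \mathcal{T}\}$, and $\gamma_h$ denotes this quantity for evenly spaced sampling with interval $h$. The smallest attenuation bound guaranteed by the schedule $\mathcal{T}$ is $\gamma_{\mathcal{T}}$; a schedule guarantees a bound $g$ if $\gamma_{\mathcal{T}}\le g$. *)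

theory Defs
  imports "HOL-Analysis.Analysis"
begin

section \<open>Linear systems\<close>

text \<open>The ring product on \<^typ>\<open>real^'n^'n\<close> is componentwise, so powers with respect to the
  matrix product are iterated explicitly.\<close>

definition matpow :: "real^'n^'n \<Rightarrow> nat \<Rightarrow> real^'n^'n" where
  "matpow A k = (((**) A) ^^ k) (mat 1)"

text \<open>Kalman's rank conditions: \<open>[B, A B, ..., A^(n-1) B]\<close> has rank \<open>n\<close>, and so has the
  stacked matrix with blocks \<open>C, C A, ..., C A^(n-1)\<close>. The matrices are given by the sets of their
  columns and rows, because the number of blocks depends on the dimension.\<close>

definition controllable :: "real^'n^'n \<Rightarrow> real^'u^'n \<Rightarrow> bool" where
  "controllable A B \<longleftrightarrow> dim (\<Union>k<CARD('n). columns (matpow A k ** B)) = CARD('n)"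

definition observable :: "real^'n^'n \<Rightarrow> real^'n^'z \<Rightarrow> bool" where
  "observable A C \<longleftrightarrow> dim (\<Union>k<CARD('n). rows (C ** matpow A k)) = CARD('n)"

definition pos_definite :: "real^'n^'n \<Rightarrow> bool" where
  "pos_definite M \<longleftrightarrow> transpose M = M \<and> (\<forall>v. v \<noteq> 0 \<longrightarrow> v \<bullet> (M *v v) > 0)"

section \<open>Sampling schedules\<close>

text \<open>A schedule is the tuple of its intervals over one period.\<close>

definition schedule :: "nat list \<Rightarrow> bool" where
  "schedule T \<longleftrightarrow> T \<noteq> [] \<and> (\<forall>\<tau>\<in>set T. \<tau> \<ge> 1)"

primrec sampling_time :: "nat list \<Rightarrow> nat \<Rightarrow> nat" where
  "sampling_time T 0 = 0"
| "sampling_time T (Suc l) = sampling_time T l + T ! (l mod length T)"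

definition sampled :: "nat list \<Rightarrow> nat \<Rightarrow> bool" where
  "sampled T t \<longleftrightarrow> t \<in> range (sampling_time T)"

definition avg_interval :: "nat list \<Rightarrow> real" where
  "avg_interval T = (\<Sum>l<length T. real (T ! l)) / real (length T)"

definition avg_rate :: "nat list \<Rightarrow> real" where
  "avg_rate T = 1 / avg_interval T"

text \<open>One period of an evenly spaced schedule may be listed several times over; all these tuples
  have the same periodic extension.\<close>

definition evenly_spaced :: "nat \<Rightarrow> nat list \<Rightarrow> bool" where
  "evenly_spaced h T \<longleftrightarrow> schedule T \<and> (\<forall>\<tau>\<in>set T. \<tau> = h)"

section \<open>Closed loop and attenuation bounds\<close>

text \<open>The information at time \<open>t\<close> is the family of the states sampled so far, together with their
  sampling times, as a partial map from times to states.\<close>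

definition info :: "nat list \<Rightarrow> (nat \<Rightarrow> real^'n) \<Rightarrow> nat \<Rightarrow> (nat \<rightharpoonup> real^'n)" where
  "info T x t = (\<lambda>r. if r \<le> t \<and> sampled T r then Some (x r) else None)"

type_synonym ('n, 'u) policy = "nat \<Rightarrow> (nat \<rightharpoonup> real^'n) \<Rightarrow> real^'u"

text \<open>For each \<open>w\<close> there is exactly one pair \<open>x\<close>, \<open>u\<close> with this property.\<close>

definition closed_loop ::
  "real^'n^'n \<Rightarrow> real^'u^'n \<Rightarrow> nat list \<Rightarrow> ('n, 'u) policy \<Rightarrow>
   (nat \<Rightarrow> real^'n) \<Rightarrow> (nat \<Rightarrow> real^'n) \<Rightarrow> (nat \<Rightarrow> real^'u) \<Rightarrow> bool" where
  "closed_loop A B T \<mu> w x u \<longleftrightarrow>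
     x 0 = 0 \<and>
     (\<forall>t. u t = \<mu> t (info T x t)) \<and>
     (\<forall>t. x (Suc t) = A *v x t + B *v u t + w t)"

definition sq_norm :: "(nat \<Rightarrow> real^'n) \<Rightarrow> ennreal" where
  "sq_norm v = (\<Sum>t. ennreal (v t \<bullet> v t))"

definition ell2 :: "(nat \<Rightarrow> real^'n) set" where
  "ell2 = {v. sq_norm v < \<infinity>}"

definition achieves ::
  "real^'n^'n \<Rightarrow> real^'u^'n \<Rightarrow> real^'n^'z \<Rightarrow> real^'u^'z \<Rightarrow> nat list \<Rightarrow> ('n, 'u) policy \<Rightarrow> real \<Rightarrow> bool"
  where
  "achieves A B C D T \<mu> \<gamma> \<longleftrightarrow>
     (\<forall>w x u. w \<in> ell2 \<and> closed_loop A B T \<mu> w x u \<longrightarrow>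
        sq_norm (\<lambda>t. C *v x t + D *v u t) \<le> ennreal (\<gamma>\<^sup>2) * sq_norm w)"

text \<open>With values in \<^typ>\<open>ennreal\<close>, the infimum is \<open>\<infinity>\<close> if no bound can be achieved.\<close>

definition gamma ::
  "real^'n^'n \<Rightarrow> real^'u^'n \<Rightarrow> real^'n^'z \<Rightarrow> real^'u^'z \<Rightarrow> nat list \<Rightarrow> ennreal" where
  "gamma A B C D T = Inf {ennreal \<gamma> | \<gamma>. \<gamma> > 0 \<and> (\<exists>\<mu>. achieves A B C D T \<mu> \<gamma>)}"

definition gamma_even ::
  "real^'n^'n \<Rightarrow> real^'u^'n \<Rightarrow> real^'n^'z \<Rightarrow> real^'u^'z \<Rightarrow> nat \<Rightarrow> ennreal" where
  "gamma_even A B C D h = gamma A B C D [h]"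

definition guarantees ::
  "real^'n^'n \<Rightarrow> real^'u^'n \<Rightarrow> real^'n^'z \<Rightarrow> real^'u^'z \<Rightarrow> nat list \<Rightarrow> ennreal \<Rightarrow> bool" where
  "guarantees A B C D T g \<longleftrightarrow> gamma A B C D T \<le> g"

text \<open>A schedule with average interval \<open>q\<close> that guarantees this infimum attains it.\<close>

definition best_bound ::
  "real^'n^'n \<Rightarrow> real^'u^'n \<Rightarrow> real^'n^'z \<Rightarrow> real^'u^'z \<Rightarrow> real \<Rightarrow> ennreal" where
  "best_bound A B C D q = (INF T\<in>{T. schedule T \<and> avg_interval T = q}. gamma A B C D T)"

end

theory Submission
  imports Defs
begin

text \<open>The attenuation bound of a schedule depends only on its largest interval, and monotonically;
  the rest is arithmetic of averages. Suppose that some policy achieves \<open>\<gamma>\<close> under \<open>T\<close>, and let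
  \<open>\<gamma> < \<gamma>'\<close>. While all samples are zero such a policy applies no control, so during an interval of
  length \<open>\<tau>\<close> the disturbance moves the state freely, and afterwards it can play the game with full
  state information for the level \<open>\<gamma>'\<close>. This bounds the values of that game over finite horizons,
  which therefore increase to a quadratic form \<open>b\<close> solving the stationary Riccati equation, and it
  bounds by \<open>0\<close> the cost, with terminal cost \<open>b\<close>, of every uncontrolled trajectory of length \<open>\<tau>\<close>
  from the state \<open>0\<close>. Conversely, let the controller apply between samples the saddle point feedback
  to a prediction of the state that assumes the saddle point disturbance. The cost over an interval,
  with terminal cost \<open>b\<close>, is then the value of \<open>b\<close> at its initial state plus the cost of the
  prediction error, and the latter is at most \<open>0\<close> if the interval has length at most \<open>\<tau>\<close>.\<close>

section \<open>Symmetric bilinear forms\<close>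

definition psd_form :: "('a::real_vector \<Rightarrow> 'a \<Rightarrow> real) \<Rightarrow> bool" where
  "psd_form b \<longleftrightarrow> bilinear b \<and> (\<forall>x y. b x y = b y x) \<and> (\<forall>x. 0 \<le> b x x)"

lemma psd_formD:
  assumes "psd_form b"
  shows "bilinear b" "b x y = b y x" "0 \<le> b x x"
  using assms by (auto simp: psd_form_def)

lemma psd_form_add:
  assumes "psd_form b"
  shows "b (x + y) (x + y) = b x x + 2 * b x y + b y y"
  using psd_formD[OF assms] by (simp add: bilinear_ladd bilinear_radd)

lemma psd_form_polar:
  assumes "psd_form b"
  shows "b x y = (b (x + y) (x + y) - b x x - b y y) / 2"
  using psd_form_add[OF assms, of x y] by simp

text \<open>A nondegenerate form embeds the space into its dual, and in finite dimension the
  embedding is onto; \<open>S\<close> is its inverse after \<open>c\<close>. This will solve the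
  stationarity equations of the game.\<close>

lemma bilinear_represented:
  fixes \<beta> :: "'e::euclidean_space \<Rightarrow> 'e \<Rightarrow> real" and c :: "'x::real_vector \<Rightarrow> 'e \<Rightarrow> real"
  assumes \<beta>: "bilinear \<beta>" and c: "bilinear c"
    and nondegenerate: "\<And>e. (\<And>f. \<beta> e f = 0) \<Longrightarrow> e = 0"
  obtains S where "linear S" "\<And>x f. \<beta> (S x) f = c x f"
proof -
  define P where "P = (\<lambda>e. \<Sum>i\<in>Basis. \<beta> e i *\<^sub>R i)"
  define R where "R = (\<lambda>x. \<Sum>i\<in>Basis. c x i *\<^sub>R i)"
  have expand: "l f = (\<Sum>i\<in>Basis. l i *\<^sub>R i) \<bullet> f" if "linear l" for l and f :: 'e
  proof -
    have "l f = l (\<Sum>i\<in>Basis. (f \<bullet> i) *\<^sub>R i)"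
      by (simp add: euclidean_representation)
    also have "\<dots> = (\<Sum>i\<in>Basis. (f \<bullet> i) *\<^sub>R l i)"
      using that by (simp add: linear_sum linear_scale)
    also have "\<dots> = (\<Sum>i\<in>Basis. l i *\<^sub>R i) \<bullet> f"
      by (simp add: inner_sum_left inner_commute[of f] mult.commute)
    finally show ?thesis .
  qed
  have P: "\<beta> e f = P e \<bullet> f" for e f
    using \<beta> by (auto simp: P_def bilinear_def intro: expand)
  have R: "c x f = R x \<bullet> f" for x f
    using c by (auto simp: R_def bilinear_def intro: expand)
  have "linear P"
    by (rule linearI)
      (simp_all add: P_def bilinear_ladd[OF \<beta>] bilinear_lmul[OF \<beta>] scaleR_left_distrib sum.distrib
        scaleR_sum_right)
  have "linear R"
    by (rule linearI)
      (simp_all add: R_def bilinear_ladd[OF c] bilinear_lmul[OF c] scaleR_left_distrib sum.distrib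
        scaleR_sum_right)
  have "inj P"
    using nondegenerate by (auto simp: linear_injective_0[OF \<open>linear P\<close>] P)
  then obtain Q where "linear Q" "\<And>x. P (Q x) = x"
    using linear_injective_isomorphism[OF \<open>linear P\<close>] by metis
  then have "linear (Q \<circ> R)" "\<And>x f. \<beta> ((Q \<circ> R) x) f = c x f"
    using \<open>linear R\<close> by (auto simp: P R linear_compose)
  then show ?thesis
    using that by blast
qed

text \<open>On the diagonal the sequence is monotone and bounded; polarisation carries convergence
  to all pairs, and the algebraic properties pass to the limit.\<close>

lemma psd_form_incseq_tendsto:
  fixes b :: "nat \<Rightarrow> 'a::real_vector \<Rightarrow> 'a \<Rightarrow> real"
  assumes psd: "\<And>i. psd_form (b i)"
    and mono: "\<And>i x. b i x x \<le> b (Suc i) x x"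
    and bound: "\<And>i x. b i x x \<le> f x"
  obtains b\<^sub>l where "psd_form b\<^sub>l" "\<And>x y. (\<lambda>i. b i x y) \<longlonglongrightarrow> b\<^sub>l x y" "\<And>i x. b i x x \<le> b\<^sub>l x x"
proof -
  have diag: "\<exists>l. (\<lambda>i. b i x x) \<longlonglongrightarrow> l \<and> (\<forall>i. b i x x \<le> l)" for x
    using incseq_convergent[of "\<lambda>i. b i x x" "f x"] mono bound by (metis incseq_SucI)
  have "convergent (\<lambda>i. b i x y)" for x y
  proof -
    obtain l l\<^sub>x l\<^sub>y where "(\<lambda>i. b i (x + y) (x + y)) \<longlonglongrightarrow> l"
      "(\<lambda>i. b i x x) \<longlonglongrightarrow> l\<^sub>x" "(\<lambda>i. b i y y) \<longlonglongrightarrow> l\<^sub>y"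
      using diag by metis
    then have "(\<lambda>i. (b i (x + y) (x + y) - b i x x - b i y y) / 2) \<longlonglongrightarrow> (l - l\<^sub>x - l\<^sub>y) / 2"
      by (intro tendsto_intros) auto
    then show ?thesis
      unfolding psd_form_polar[OF psd, of _ x y] by (rule convergentI)
  qed
  then have lim: "(\<lambda>i. b i x y) \<longlonglongrightarrow> lim (\<lambda>i. b i x y)" for x y
    by (simp add: convergent_LIMSEQ_iff)
  define b\<^sub>l where "b\<^sub>l = (\<lambda>x y. lim (\<lambda>i. b i x y))"
  have tends: "(\<lambda>i. b i x y) \<longlonglongrightarrow> b\<^sub>l x y" for x y
    using lim by (simp add: b\<^sub>l_def)
  have le: "b i x x \<le> b\<^sub>l x x" for i x
    using diag[of x] tends[of x x] LIMSEQ_unique by blast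
  have sym: "b\<^sub>l x y = b\<^sub>l y x" for x y
    unfolding b\<^sub>l_def using psd_formD(2)[OF psd] by metis
  have add: "b\<^sub>l (x + y) z = b\<^sub>l x z + b\<^sub>l y z" for x y z
    using tendsto_add[OF tends[of x z] tends[of y z]] tends[of "x + y" z]
    by (auto simp: bilinear_ladd[OF psd_formD(1)[OF psd]] intro: LIMSEQ_unique)
  have scale: "b\<^sub>l (r *\<^sub>R x) z = r * b\<^sub>l x z" for r x z
    using tendsto_mult_left[OF tends[of x z], of r] tends[of "r *\<^sub>R x" z]
    by (auto simp: bilinear_lmul[OF psd_formD(1)[OF psd]] intro: LIMSEQ_unique)
  have linear: "linear (\<lambda>x. b\<^sub>l x z)" for z
    by (rule linearI) (simp_all add: add scale)
  have "bilinear b\<^sub>l"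
    unfolding bilinear_def
  proof (intro conjI allI)
    show "linear (\<lambda>y. b\<^sub>l x y)" for x
      using linear[of x] by (simp add: sym[of x])
  qed (rule linear)
  moreover have "0 \<le> b\<^sub>l x x" for x
    using le[of 0 x] psd_formD(3)[OF psd, of 0 x] by simp
  ultimately have "psd_form b\<^sub>l"
    using sym by (auto simp: psd_form_def)
  then show ?thesis
    using that tends le by blast
qed

section \<open>The game with full information\<close>

locale lq_game =
  fixes A :: "'x::euclidean_space \<Rightarrow> 'x" and B :: "'u::euclidean_space \<Rightarrow> 'x"
    and C :: "'x \<Rightarrow> 'z::euclidean_space" and D :: "'u \<Rightarrow> 'z"
  assumes linear_A: "linear A" and linear_B: "linear B"
    and linear_C: "linear C" and linear_D: "linear D"
    and inj_D: "inj D"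
begin

text \<open>The running payoff, minimised by the control and maximised by the disturbance;
  \<open>g\<close> stands for the squared attenuation level. Orthogonal outputs leave no cross term
  of \<open>C x\<close> and \<open>D u\<close>.\<close>

definition stage :: "real \<Rightarrow> 'x \<Rightarrow> 'u \<Rightarrow> 'x \<Rightarrow> real" where
  "stage g x u w = C x \<bullet> C x + D u \<bullet> D u - g * (w \<bullet> w)"

text \<open>\<open>(K x, W x)\<close> is the stationary point of \<open>stage g x u w + b y y\<close> with \<open>y = A x + B u + w\<close>,
  and \<open>b' x x\<close> is the value there; the last equation is the polarised value after cancelling the
  terms that vanish by stationarity.\<close>

definition riccati ::
  "real \<Rightarrow> ('x \<Rightarrow> 'x \<Rightarrow> real) \<Rightarrow> ('x \<Rightarrow> 'u) \<Rightarrow> ('x \<Rightarrow> 'x) \<Rightarrow> ('x \<Rightarrow> 'x \<Rightarrow> real) \<Rightarrow> bool" where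
  "riccati g b K W b' \<longleftrightarrow>
     (\<forall>x a. D (K x) \<bullet> D a + b (A x + B (K x) + W x) (B a) = 0) \<and>
     (\<forall>x d. b (A x + B (K x) + W x) d = g * (W x \<bullet> d)) \<and>
     (\<forall>x e. b' x e = C x \<bullet> C e + b (A x + B (K x) + W x) (A e))"

text \<open>An exact second order expansion: terms linear in \<open>a\<close> and \<open>d\<close>
  vanish by stationarity, those linear in \<open>e\<close> collect to \<open>2 * b' x e\<close>, and
  the quadratic rest is the payoff of the perturbation itself.\<close>

lemma riccati_expand:
  assumes b: "psd_form b" and ric: "riccati g b K W b'"
    and y: "y = A (x + e) + B (K x + a) + (W x + d)"
    and m: "m = A e + B a + d"
  shows "stage g (x + e) (K x + a) (W x + d) + b y y
         = b' x x + 2 * b' x e + stage g e a d + b m m"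
proof -
  define n where "n = A x + B (K x) + W x"
  note radd = bilinear_radd[OF psd_formD(1)[OF b]]
  have su: "b n (B a) = - (D (K x) \<bullet> D a)" for a
    using ric by (auto simp: riccati_def n_def add_eq_0_iff)
  have sw: "b n d = g * (W x \<bullet> d)" for d
    using ric by (auto simp: riccati_def n_def)
  have sx: "b n (A e) = b' x e - C x \<bullet> C e" for e
    using ric by (auto simp: riccati_def n_def)
  have nn: "b n n = b' x x - C x \<bullet> C x - D (K x) \<bullet> D (K x) + g * (W x \<bullet> W x)"
  proof -
    have "b n n = b n (A x) + b n (B (K x)) + b n (W x)"
      unfolding radd[symmetric] by (simp add: n_def)
    then show ?thesis
      unfolding su sx sw[of "W x"] by simp
  qed
  have nm: "b n m = b' x e - C x \<bullet> C e - D (K x) \<bullet> D a + g * (W x \<bullet> d)"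
    unfolding m radd su sx by (simp add: sw)
  have "y = n + m"
    by (simp add: y n_def m linear_add[OF linear_A] linear_add[OF linear_B])
  then have "b y y = b n n + 2 * b n m + b m m"
    using psd_form_add[OF b] by simp
  then show ?thesis
    unfolding nn nm stage_def linear_add[OF linear_C] linear_add[OF linear_D]
    by (simp add: inner_commute algebra_simps)
qed

lemma riccati_zero_right:
  assumes "psd_form b" "riccati g b K W b'"
  shows "b' x 0 = 0"
  using assms
  by (simp add: riccati_def linear_0[OF linear_A] linear_0[OF linear_C] psd_form_def bilinear_rzero)

text \<open>The payoff is convex in the control, so against \<open>W x\<close> a deviation from
  \<open>K x\<close> only adds nonnegative quadratic terms.\<close>

lemma riccati_lower:
  assumes "psd_form b" "riccati g b K W b'"
  shows "b' x x \<le> stage g x u (W x) + b (A x + B u + W x) (A x + B u + W x)"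
proof -
  have "0 \<le> b (B (u - K x)) (B (u - K x))"
    using assms(1) by (rule psd_formD)
  then show ?thesis
    using riccati_expand[OF assms refl refl, of x 0 "u - K x" 0]
    by (simp add: stage_def linear_0[OF linear_A] linear_0[OF linear_C] riccati_zero_right[OF assms])
qed

text \<open>\<open>bound\<close> makes the payoff concave in the disturbance, so deviating from
  \<open>W x\<close> gains nothing against \<open>K x\<close>.\<close>

lemma riccati_upper:
  assumes "psd_form b" "riccati g b K W b'" and bound: "\<And>z. b z z \<le> g * (z \<bullet> z)"
  shows "stage g x (K x) w + b (A x + B (K x) + w) (A x + B (K x) + w) \<le> b' x x"
  using riccati_expand[OF assms(1,2) refl refl, of x 0 0 "w - W x"] bound[of "w - W x"]
  by (simp add: stage_def linear_0[OF linear_A] linear_0[OF linear_B] linear_0[OF linear_C]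
      linear_0[OF linear_D] riccati_zero_right[OF assms(1,2)])

text \<open>The saddle point disturbance for \<open>b\<^sub>1\<close> is played against the saddle
  point control for \<open>b\<^sub>2\<close>.\<close>

lemma riccati_mono:
  assumes b\<^sub>1: "psd_form b\<^sub>1" "riccati g b\<^sub>1 K\<^sub>1 W\<^sub>1 b\<^sub>1'"
    and b\<^sub>2: "psd_form b\<^sub>2" "riccati g b\<^sub>2 K\<^sub>2 W\<^sub>2 b\<^sub>2'"
    and le: "\<And>x. b\<^sub>1 x x \<le> b\<^sub>2 x x" and bound: "\<And>z. b\<^sub>2 z z \<le> g * (z \<bullet> z)"
  shows "b\<^sub>1' x x \<le> b\<^sub>2' x x"
proof -
  let ?y = "A x + B (K\<^sub>2 x) + W\<^sub>1 x"
  have "b\<^sub>1' x x \<le> stage g x (K\<^sub>2 x) (W\<^sub>1 x) + b\<^sub>1 ?y ?y"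
    by (rule riccati_lower[OF b\<^sub>1])
  also have "\<dots> \<le> stage g x (K\<^sub>2 x) (W\<^sub>1 x) + b\<^sub>2 ?y ?y"
    using le by simp
  also have "\<dots> \<le> b\<^sub>2' x x"
    by (rule riccati_upper[OF b\<^sub>2 bound])
  finally show ?thesis .
qed

text \<open>The margin between \<open>g\<^sub>0\<close> and \<open>g\<close> makes the payoff
  strictly concave in the disturbance, and injectivity of \<open>D\<close> makes it strictly convex
  in the control; hence the linear stationarity equations are uniquely solvable.\<close>

lemma riccati_exists:
  assumes b: "psd_form b" and bound: "\<And>z. b z z \<le> g\<^sub>0 * (z \<bullet> z)" and "g\<^sub>0 < g"
  obtains K W b' where "psd_form b'" "riccati g b K W b'"
proof -
  note bil = psd_formD(1)[OF b]
  note sym = psd_formD(2)[OF b]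
  note lin_simps = linear_add[OF linear_A] linear_add[OF linear_B] linear_add[OF linear_C]
    linear_add[OF linear_D] linear_scale[OF linear_A] linear_scale[OF linear_B]
    linear_scale[OF linear_C] linear_scale[OF linear_D]
    linear_0[OF linear_A] linear_0[OF linear_B] linear_0[OF linear_C] linear_0[OF linear_D]
    bilinear_ladd[OF bil] bilinear_radd[OF bil] bilinear_lmul[OF bil] bilinear_rmul[OF bil]
    bilinear_rzero[OF bil] bilinear_lzero[OF bil]
  have strict: "b z z \<le> g * (z \<bullet> z)" for z
    using bound[of z] \<open>g\<^sub>0 < g\<close> mult_right_mono[of g\<^sub>0 g "z \<bullet> z"] by simp
  \<comment> \<open>Both stationarity conditions in one form, the one for the disturbance with
    reversed sign, so that the mixed terms cancel at equal arguments.\<close>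
  define \<beta> :: "'u \<times> 'x \<Rightarrow> 'u \<times> 'x \<Rightarrow> real" where
    "\<beta> = (\<lambda>e f. D (fst e) \<bullet> D (fst f) + b (B (fst e) + snd e) (B (fst f))
             + (g * (snd e \<bullet> snd f) - b (B (fst e) + snd e) (snd f)))"
  define c :: "'x \<Rightarrow> 'u \<times> 'x \<Rightarrow> real" where
    "c = (\<lambda>x f. b (A x) (snd f) - b (A x) (B (fst f)))"
  have "bilinear \<beta>" "bilinear c"
    unfolding bilinear_def
    by (auto intro!: linearI simp: \<beta>_def c_def lin_simps algebra_simps)
  moreover have "e = 0" if null: "\<And>f. \<beta> e f = 0" for e
  proof -
    obtain u w where e: "e = (u, w)"
      by (cases e)
    have u: "D u \<bullet> D u + b (B u) (B u) + b w (B u) = 0"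
      using null[of "(u, 0)"] by (simp add: e \<beta>_def lin_simps)
    have w: "g * (w \<bullet> w) - b w w = b w (B u)"
      using null[of "(0, w)"] sym[of w "B u"] by (simp add: e \<beta>_def lin_simps)
    have "0 \<le> D u \<bullet> D u" "0 \<le> b (B u) (B u)" "0 \<le> g * (w \<bullet> w) - b w w"
      using psd_formD(3)[OF b] strict[of w] by auto
    then have "D u \<bullet> D u = 0" "g * (w \<bullet> w) - b w w = 0"
      using u w by linarith+
    then have "D u = 0" "(g - g\<^sub>0) * (w \<bullet> w) \<le> 0"
      using bound[of w] by (auto simp: algebra_simps)
    then have "u = 0" "w \<bullet> w = 0"
      using inj_D \<open>g\<^sub>0 < g\<close> inner_ge_zero[of w]
      by (auto simp: linear_injective_0[OF linear_D] mult_le_0_iff simp del: inner_ge_zero)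
    then show ?thesis
      by (simp add: e zero_prod_def)
  qed
  ultimately obtain S where S: "linear S" "\<And>x f. \<beta> (S x) f = c x f"
    using bilinear_represented[of \<beta> c] by metis
  define K W where "K = (\<lambda>x. fst (S x))" and "W = (\<lambda>x. snd (S x))"
  define n where "n = (\<lambda>x. A x + B (K x) + W x)"
  define b' where "b' = (\<lambda>x e. C x \<bullet> C e + b (n x) (A e))"
  have stat_u: "D (K x) \<bullet> D a + b (n x) (B a) = 0" for x a
    using S(2)[of x "(a, 0)"] by (simp add: \<beta>_def c_def K_def W_def n_def lin_simps)
  have stat_w: "b (n x) d = g * (W x \<bullet> d)" for x d
    using S(2)[of x "(0, d)"] by (simp add: \<beta>_def c_def K_def W_def n_def lin_simps)
  have ric: "riccati g b K W b'"
    using stat_u stat_w by (simp add: riccati_def n_def b'_def)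
  \<comment> \<open>The definition of \<open>b'\<close> hides its symmetry; stationarity tested
    against \<open>K e\<close> and \<open>W e\<close> brings it out.\<close>
  have b'_eq: "b' x e = C x \<bullet> C e + D (K x) \<bullet> D (K e) - g * (W x \<bullet> W e) + b (n x) (n e)" for x e
  proof -
    have "b (n x) (n e) = b (n x) (A e) + b (n x) (B (K e)) + b (n x) (W e)"
      unfolding bilinear_radd[OF bil, symmetric] by (simp add: n_def)
    then show ?thesis
      using stat_u[of x "K e"] stat_w[of x "W e"] by (simp add: b'_def)
  qed
  have linear: "linear (\<lambda>e. b' x e)" for x
    by (rule linearI) (simp_all add: b'_def lin_simps algebra_simps)
  have sym': "b' x e = b' e x" for x e
    using sym[of "n x" "n e"] by (simp add: b'_eq inner_commute)
  have "bilinear b'"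
    unfolding bilinear_def using linear sym' by presburger
  moreover have "0 \<le> b' x x" for x
  proof -
    have "0 \<le> stage g x (K x) 0 + b (A x + B (K x) + 0) (A x + B (K x) + 0)"
      using psd_formD(3)[OF b] by (simp add: stage_def)
    also have "\<dots> \<le> b' x x"
      by (rule riccati_upper[OF b ric strict])
    finally show ?thesis .
  qed
  ultimately have "psd_form b'"
    using sym' by (auto simp: psd_form_def)
  then show ?thesis
    using ric that by blast
qed

text \<open>The iterates increase because each step is monotone. For stationarity of the limit, one
  inequality is again monotonicity; the other uses compactness to extract a limit of the controls
  \<open>K i x\<close>.\<close>

lemma riccati_limit:
  assumes psd: "\<And>i. psd_form (b i)" and b_0: "\<And>x. b 0 x x = 0"
    and ric: "\<And>i. riccati g (b i) (K i) (W i) (b (Suc i))"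
    and bound: "\<And>i x. b i x x \<le> g\<^sub>0 * (x \<bullet> x)" and "g\<^sub>0 < g"
  obtains b\<^sub>l K\<^sub>l W\<^sub>l where "psd_form b\<^sub>l" "riccati g b\<^sub>l K\<^sub>l W\<^sub>l b\<^sub>l"
    "\<And>x. (\<lambda>i. b i x x) \<longlonglongrightarrow> b\<^sub>l x x"
proof -
  have strict: "b i x x \<le> g * (x \<bullet> x)" for i x
    using bound[of i x] \<open>g\<^sub>0 < g\<close> mult_right_mono[of g\<^sub>0 g "x \<bullet> x"] by simp
  have mono: "b i x x \<le> b (Suc i) x x" for i x
  proof (induction i arbitrary: x)
    case 0
    then show ?case
      using psd_formD(3)[OF psd] by (simp add: b_0)
  next
    case (Suc i)
    show ?case
      by (rule riccati_mono[OF psd ric psd ric Suc strict])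
  qed
  obtain b\<^sub>l where b\<^sub>l: "psd_form b\<^sub>l" and lim: "\<And>x y. (\<lambda>i. b i x y) \<longlonglongrightarrow> b\<^sub>l x y"
    and le: "\<And>i x. b i x x \<le> b\<^sub>l x x"
    using psd_form_incseq_tendsto[of b, OF psd mono bound] by blast
  have bound_l: "b\<^sub>l x x \<le> g\<^sub>0 * (x \<bullet> x)" for x
    by (rule LIMSEQ_le_const2[OF lim]) (use bound in blast)
  have strict_l: "b\<^sub>l x x \<le> g * (x \<bullet> x)" for x
    by (rule LIMSEQ_le_const2[OF lim]) (use strict in blast)
  obtain K\<^sub>l W\<^sub>l b' where b': "psd_form b'" and ric_l: "riccati g b\<^sub>l K\<^sub>l W\<^sub>l b'"
    using riccati_exists[of b\<^sub>l, OF b\<^sub>l bound_l \<open>g\<^sub>0 < g\<close>] by blast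
  have "b\<^sub>l x x \<le> b' x x" for x
  proof (rule LIMSEQ_le_const2[OF LIMSEQ_Suc[OF lim]])
    show "\<exists>N. \<forall>n\<ge>N. b (Suc n) x x \<le> b' x x"
      using riccati_mono[OF psd ric b\<^sub>l ric_l le strict_l] by blast
  qed
  moreover have "b' x x \<le> b\<^sub>l x x" for x
  proof -
    define u where "u = (\<lambda>i. K i x)"
    have upper: "stage g x (u i) w + b i (A x + B (u i) + w) (A x + B (u i) + w) \<le> b\<^sub>l x x" for i w
      unfolding u_def using riccati_upper[OF psd ric strict] le order_trans by blast
    \<comment> \<open>Against the zero disturbance the control cost alone stays below the limit
      value; injectivity of \<open>D\<close> then bounds the controls.\<close>
    have "D (u i) \<bullet> D (u i) \<le> b\<^sub>l x x" for i
      using upper[of i 0] psd_formD(3)[OF psd, of i "A x + B (u i)"] inner_ge_zero[of "C x"]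
      unfolding stage_def by (simp del: inner_ge_zero)
    then have norm_Du: "norm (D (u i)) \<le> sqrt (b\<^sub>l x x)" for i
      by (simp add: norm_eq_sqrt_inner)
    obtain k where "0 < k" and k: "\<And>v. k * norm v \<le> norm (D v)"
      using linear_inj_bounded_below_pos[OF linear_D inj_D] by blast
    have "norm (u i) \<le> sqrt (b\<^sub>l x x) / k" for i
      using order_trans[OF k norm_Du] \<open>0 < k\<close> by (simp add: pos_le_divide_eq mult.commute)
    then have "bounded (range u)"
      by (auto simp: bounded_iff)
    then obtain v r where r: "strict_mono r" and v: "(u \<circ> r) \<longlonglongrightarrow> v"
      using bounded_imp_convergent_subsequence by blast
    \<comment> \<open>The index \<open>M\<close> is frozen while the controls converge and sent to
      infinity afterwards; monotonicity bounds \<open>b M\<close> by the later forms.\<close>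
    have limit: "stage g x v w + b M (A x + B v + w) (A x + B v + w) \<le> b\<^sub>l x x" for w M
    proof -
      have le_Mi: "b M y y \<le> b i y y" if "M \<le> i" for i y
        using lift_Suc_mono_le[of "\<lambda>i. b i y y", OF mono that] .
      have "(\<lambda>i. stage g x ((u \<circ> r) i) w + b M (A x + B ((u \<circ> r) i) + w) (A x + B ((u \<circ> r) i) + w))
            \<longlonglongrightarrow> stage g x v w + b M (A x + B v + w) (A x + B v + w)"
        unfolding stage_def
        by (intro tendsto_intros v bounded_linear.tendsto[of D] bounded_linear.tendsto[of B]
            bounded_bilinear.tendsto[of "b M"])
          (use linear_B linear_D psd_formD(1)[OF psd]
            in \<open>simp_all add: bilinear_conv_bounded_bilinear linear_conv_bounded_linear\<close>)
      then show ?thesis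
      proof (rule LIMSEQ_le_const2)
        have "stage g x (u (r i)) w + b M (A x + B (u (r i)) + w) (A x + B (u (r i)) + w) \<le> b\<^sub>l x x"
          if "M \<le> i" for i
          using upper[of "r i" w] le_Mi[of "r i" "A x + B (u (r i)) + w"]
            seq_suble[OF r, of i] that by linarith
        then show "\<exists>N. \<forall>i\<ge>N. stage g x ((u \<circ> r) i) w
            + b M (A x + B ((u \<circ> r) i) + w) (A x + B ((u \<circ> r) i) + w) \<le> b\<^sub>l x x"
          by auto
      qed
    qed
    have "stage g x v w + b\<^sub>l (A x + B v + w) (A x + B v + w) \<le> b\<^sub>l x x" for w
      by (rule LIMSEQ_le_const2[OF tendsto_add[OF tendsto_const lim]]) (use limit in blast)
    then show ?thesis
      using riccati_lower[OF b\<^sub>l ric_l] order_trans by blast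
  qed
  ultimately have "b' x x = b\<^sub>l x x" for x
    by (rule order_antisym[rotated])
  then have "b' x y = b\<^sub>l x y" for x y
    using psd_form_polar[OF b', of x y] psd_form_polar[OF b\<^sub>l, of x y] by simp
  then have "b' = b\<^sub>l"
    by (intro ext)
  show ?thesis
  proof (rule that)
    show "riccati g b\<^sub>l K\<^sub>l W\<^sub>l b\<^sub>l"
      using ric_l by (simp only: \<open>b' = b\<^sub>l\<close>)
  qed (fact b\<^sub>l lim)+
qed

text \<open>\<open>v N\<close> is a value that the disturbance can secure over \<open>N\<close> stages against any control.\<close>

definition lower_values :: "real \<Rightarrow> (nat \<Rightarrow> 'x \<Rightarrow> real) \<Rightarrow> nat \<Rightarrow> bool" where
  "lower_values g v N \<longleftrightarrow> (\<forall>x. v 0 x = 0) \<and>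
     (\<forall>i<N. \<forall>x u. \<exists>w. v (Suc i) x \<le> stage g x u w + v i (A x + B u + w))"

text \<open>Each iterate is a lower value, so \<open>bound\<close> applies to it and makes the next
  step solvable; construction and bound share one induction.\<close>

lemma riccati_fixed_point:
  assumes bound: "\<And>v N x. lower_values g v N \<Longrightarrow> v N x \<le> g\<^sub>0 * (x \<bullet> x)" and "g\<^sub>0 < g"
  obtains b K W v where "psd_form b" "riccati g b K W b" "\<And>N. lower_values g v N"
    "\<And>x. (\<lambda>i. v i x) \<longlonglongrightarrow> b x x"
proof -
  \<comment> \<open>Choice makes the step total before solvability is known; the induction shows
    that it picks a solution at every iterate.\<close>
  define step where "step = (\<lambda>b. SOME b'. psd_form b' \<and> (\<exists>K W. riccati g b K W b'))"
  define b where "b = (\<lambda>i. (step ^^ i) (\<lambda>_ _. 0))"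
  define v where "v = (\<lambda>i x. b i x x)"
  have b_0: "b 0 x y = 0" for x y
    by (simp add: b_def)
  have lower: "psd_form (b N) \<and> lower_values g v N" for N
  proof (induction N)
    case 0
    have "bilinear (\<lambda>(x::'x) (y::'x). 0 :: real)"
      by (simp add: bilinear_def linear_zero)
    then show ?case
      by (simp add: psd_form_def lower_values_def v_def b_def)
  next
    case (Suc N)
    then have b_N: "psd_form (b N)" "\<And>x. b N x x \<le> g\<^sub>0 * (x \<bullet> x)"
      using bound[of v N] by (auto simp: v_def)
    have "\<exists>b'. psd_form b' \<and> (\<exists>K W. riccati g (b N) K W b')"
      using riccati_exists[of "b N", OF b_N \<open>g\<^sub>0 < g\<close>] by metis
    then have "psd_form (b (Suc N)) \<and> (\<exists>K W. riccati g (b N) K W (b (Suc N)))"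
      using someI_ex[of "\<lambda>b'. psd_form b' \<and> (\<exists>K W. riccati g (b N) K W b')"]
      by (simp add: b_def step_def)
    then obtain K W where "psd_form (b (Suc N))" "riccati g (b N) K W (b (Suc N))"
      by blast
    then show ?case
      using Suc riccati_lower[OF b_N(1)] by (fastforce simp: lower_values_def v_def less_Suc_eq)
  qed
  have bound_b: "b i x x \<le> g\<^sub>0 * (x \<bullet> x)" for i x
    using bound lower by (auto simp: v_def)
  have "\<exists>K W. riccati g (b i) K W (b (Suc i))" for i
  proof -
    have "\<exists>b'. psd_form b' \<and> (\<exists>K W. riccati g (b i) K W b')"
      using riccati_exists[of "b i", OF _ bound_b \<open>g\<^sub>0 < g\<close>] lower by metis
    then show ?thesis
      using someI_ex[of "\<lambda>b'. psd_form b' \<and> (\<exists>K W. riccati g (b i) K W b')"]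
      by (simp add: b_def step_def)
  qed
  then obtain K W where "\<And>i. riccati g (b i) (K i) (W i) (b (Suc i))"
    by metis
  then obtain b\<^sub>l K\<^sub>l W\<^sub>l where "psd_form b\<^sub>l" "riccati g b\<^sub>l K\<^sub>l W\<^sub>l b\<^sub>l"
    "\<And>x. (\<lambda>i. b i x x) \<longlonglongrightarrow> b\<^sub>l x x"
    using riccati_limit[of b g K W g\<^sub>0] lower b_0 bound_b \<open>g\<^sub>0 < g\<close> by metis
  then show ?thesis
    using lower by (intro that[of b\<^sub>l K\<^sub>l W\<^sub>l v]) (simp_all add: v_def)
qed

section \<open>Open loop control between two samples\<close>

lemma sum_lessThan_add:
  fixes f :: "nat \<Rightarrow> 'a::comm_monoid_add"
  shows "(\<Sum>t<m + n. f t) = (\<Sum>t<m. f t) + (\<Sum>t<n. f (m + t))"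
  by (induction n) (simp_all add: add.assoc)

text \<open>The cost of an error \<open>e\<close> of the open loop prediction, and of the disturbance causing it.\<close>

definition error_cost :: "real \<Rightarrow> (nat \<Rightarrow> 'x) \<Rightarrow> nat \<Rightarrow> real" where
  "error_cost g e k = (\<Sum>t<k. stage g (e t) 0 (e (Suc t) - A (e t)))"

text \<open>On the predicted trajectory \<open>(K x, W x)\<close> is stationary, so all terms linear in the error cancel
  and what remains telescopes to \<open>error_cost\<close>.\<close>

lemma open_loop_bound:
  assumes b: "psd_form b" and ric: "riccati g b K W b"
    and error: "\<And>e. e 0 = 0 \<Longrightarrow> error_cost g e k + b (e k) (e k) \<le> 0"
    and u: "\<And>t. t < k \<Longrightarrow> u t = K (((\<lambda>x. A x + B (K x) + W x) ^^ t) (x 0))"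
    and x: "\<And>t. t < k \<Longrightarrow> x (Suc t) = A (x t) + B (u t) + w t"
  shows "(\<Sum>t<k. stage g (x t) (u t) (w t)) + b (x k) (x k) \<le> b (x 0) (x 0)"
proof -
  define p where "p = (\<lambda>t. ((\<lambda>x. A x + B (K x) + W x) ^^ t) (x 0))"
  define e where "e = (\<lambda>t. x t - p t)"
  have p: "p (Suc t) = A (p t) + B (K (p t)) + W (p t)" for t
    by (simp add: p_def)
  have u': "u t = K (p t)" if "t < k" for t
    using u[OF that] by (simp add: p_def)
  have step: "stage g (x t) (u t) (w t) + b (x (Suc t)) (x (Suc t)) - b (x t) (x t)
      = stage g (e t) 0 (e (Suc t) - A (e t)) + b (e (Suc t)) (e (Suc t)) - b (e t) (e t)"
    if "t < k" for t
  proof -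
    define d where "d = w t - W (p t)"
    have xt: "x t = p t + e t" "u t = K (p t) + 0" "w t = W (p t) + d"
      using u'[OF that] by (auto simp: e_def d_def)
    have e_Suc: "e (Suc t) = A (e t) + B 0 + d"
      by (simp add: e_def x[OF that] p u'[OF that] d_def linear_0[OF linear_B]
          linear_diff[OF linear_A])
    have "x (Suc t) = A (p t + e t) + B (K (p t) + 0) + (W (p t) + d)"
      using x[OF that] by (simp only: xt)
    then have "stage g (p t + e t) (K (p t) + 0) (W (p t) + d) + b (x (Suc t)) (x (Suc t))
        = b (p t) (p t) + 2 * b (p t) (e t) + stage g (e t) 0 d + b (e (Suc t)) (e (Suc t))"
      by (rule riccati_expand[OF b ric _ e_Suc])
    moreover have "b (x t) (x t) = b (p t) (p t) + 2 * b (p t) (e t) + b (e t) (e t)"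
      unfolding xt(1) by (rule psd_form_add[OF b])
    moreover have "d = e (Suc t) - A (e t)"
      by (simp add: e_Suc linear_0[OF linear_B])
    ultimately show ?thesis
      unfolding xt by simp
  qed
  have "(\<Sum>t<k. stage g (x t) (u t) (w t)) + b (x k) (x k) - b (x 0) (x 0)
      = (\<Sum>t<k. stage g (x t) (u t) (w t) + b (x (Suc t)) (x (Suc t)) - b (x t) (x t))"
    using sum_lessThan_telescope[of "\<lambda>t. b (x t) (x t)" k]
    by (simp add: sum.distrib sum_subtractf)
  also have "\<dots> = (\<Sum>t<k. stage g (e t) 0 (e (Suc t) - A (e t))
      + b (e (Suc t)) (e (Suc t)) - b (e t) (e t))"
    using step by simp
  also have "\<dots> = error_cost g e k + b (e k) (e k) - b (e 0) (e 0)"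
    using sum_lessThan_telescope[of "\<lambda>t. b (e t) (e t)" k]
    by (simp add: error_cost_def sum.distrib sum_subtractf)
  also have "\<dots> \<le> 0"
    using error[of e] psd_formD(3)[OF b, of "e 0"] by (simp add: e_def p_def)
  finally show ?thesis
    by simp
qed

text \<open>Truncated subtraction holds the error at 0 for the first \<open>s\<close> steps, which
  cost nothing.\<close>

lemma error_cost_delay:
  assumes "e 0 = 0"
  shows "error_cost g (\<lambda>t. e (t - s)) (s + k) = error_cost g e k"
  unfolding error_cost_def sum_lessThan_add
  by (simp add: stage_def assms Suc_diff_le linear_0[OF linear_A] linear_0[OF linear_C]
      linear_0[OF linear_D])

lemma error_cost_antimono:
  "g \<le> g' \<Longrightarrow> error_cost g' e k \<le> error_cost g e k"
  unfolding error_cost_def stage_def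
  by (intro sum_mono) (simp add: mult_right_mono)

text \<open>Preceded by \<open>\<tau> - k\<close> idle steps, an error over \<open>k\<close> steps
  becomes one over \<open>\<tau>\<close> steps with the same cost and endpoint.\<close>

lemma error_bound_shorter:
  assumes "\<And>e. e 0 = 0 \<Longrightarrow> error_cost g e \<tau> + V (e \<tau>) \<le> 0" and "k \<le> \<tau>" and "e 0 = 0"
  shows "error_cost g e k + V (e k) \<le> 0"
  using assms(1)[of "\<lambda>t. e (t - (\<tau> - k))"] error_cost_delay[of e g "\<tau> - k" k] assms(2,3) by simp

end

section \<open>Matrix systems\<close>

lemma lq_game_matrix:
  fixes A :: "real^'n^'n" and B :: "real^'u^'n" and C :: "real^'n^'z" and D :: "real^'u^'z"
  assumes "pos_definite (transpose D ** D)"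
  shows "lq_game ((*v) A) ((*v) B) ((*v) C) ((*v) D)"
proof
  have "u = 0" if "D *v u = 0" for u
    using assms that
    by (metis inner_zero_right less_irrefl matrix_vector_mul_assoc matrix_vector_mult_0_right
        pos_definite_def)
  then show "inj ((*v) D)"
    by (simp add: linear_injective_0)
qed (auto simp: matrix_vector_right_distrib matrix_vector_mult_scaleR)

lemma inner_orthogonal_output:
  fixes C :: "real^'n^'z" and D :: "real^'u^'z"
  assumes "transpose C ** D = 0"
  shows "(C *v x + D *v u) \<bullet> (C *v x + D *v u) = (C *v x) \<bullet> (C *v x) + (D *v u) \<bullet> (D *v u)"
proof -
  have "(C *v x) \<bullet> (D *v u) = x \<bullet> ((transpose C ** D) *v u)"
    by (metis dot_lmul_matrix matrix_vector_mul_assoc transpose_matrix_vector inner_commute)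
  then show ?thesis
    by (simp add: assms inner_add_left inner_add_right inner_commute)
qed

section \<open>Schedules and closed loops\<close>

lemma sampling_time_strict_mono:
  assumes "schedule T"
  shows "strict_mono (sampling_time T)"
proof (rule strict_monoI_Suc)
  show "sampling_time T l < sampling_time T (Suc l)" for l
    using assms by (simp add: schedule_def Suc_le_eq)
qed

lemma sampled_before_next:
  assumes "schedule T" "sampled T r" "r < sampling_time T (Suc l)"
  shows "r \<le> sampling_time T l"
  using assms sampling_time_strict_mono[OF assms(1)]
  by (auto simp: sampled_def strict_mono_less strict_mono_less_eq simp del: sampling_time.simps)

lemma sampling_interval_le_Max:
  assumes "schedule T"
  shows "sampling_time T (Suc l) \<le> sampling_time T l + Max (set T)"
  using assms by (auto simp: schedule_def intro!: Max_ge nth_mem)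

lemma schedule_interval_occurs:
  assumes "\<tau> \<in> set T"
  obtains l where "sampling_time T (Suc l) = sampling_time T l + \<tau>"
proof -
  obtain l where "l < length T" "T ! l = \<tau>"
    using assms by (auto simp: in_set_conv_nth)
  then show ?thesis
    using that[of l] by simp
qed

lemma info_cong:
  assumes "\<And>r. r \<le> t \<Longrightarrow> sampled T r \<Longrightarrow> x r = y r"
  shows "info T x t = info T y t"
  using assms by (auto simp: info_def)

text \<open>The disturbance may react to the current state and control, as the strategies behind
  \<open>lower_values\<close> do.\<close>

lemma closed_loop_exists:
  obtains x u where "closed_loop A B T \<mu> (\<lambda>t. \<omega> t (x t) (u t)) x u"
proof -
  define step where "step = (\<lambda>t X. A *v X t + B *v \<mu> t (info T X t) + \<omega> t (X t) (\<mu> t (info T X t)))"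
  \<comment> \<open>The policy reads the whole past, so the recursion builds sequences;
    \<open>X t\<close> is correct up to time \<open>t\<close>.\<close>
  define X where "X = rec_nat (\<lambda>_. 0) (\<lambda>t X. X(Suc t := step t X))"
  define x where "x = (\<lambda>t. X t t)"
  have past: "X t r = x r" if "r \<le> t" for t r
    using that
  proof (induction t)
    case (Suc t)
    then show ?case
      by (cases "r = Suc t") (simp_all add: x_def X_def)
  qed (simp add: x_def)
  have info: "info T (X t) t = info T x t" for t
    using past by (intro info_cong)
  have "x (Suc t) = A *v x t + B *v \<mu> t (info T x t) + \<omega> t (x t) (\<mu> t (info T x t))" for t
  proof -
    have "x (Suc t) = step t (X t)"
      by (simp add: x_def X_def)
    then show ?thesis
      by (simp add: step_def info past)
  qed
  moreover have "x 0 = 0"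
    by (simp add: x_def X_def)
  ultimately show ?thesis
    using that[of x "\<lambda>t. \<mu> t (info T x t)"] by (simp add: closed_loop_def)
qed

section \<open>Attenuation bounds and the game\<close>

context
  fixes A :: "real^'n^'n" and B :: "real^'u^'n" and C :: "real^'n^'z" and D :: "real^'u^'z"
  assumes orth: "transpose C ** D = 0" and pos: "pos_definite (transpose D ** D)"
begin

interpretation lq_game "(*v) A" "(*v) B" "(*v) C" "(*v) D"
  by (rule lq_game_matrix[OF pos])

lemma achieves_stage_sum:
  assumes ach: "achieves A B C D T \<mu> \<gamma>" and cl: "closed_loop A B T \<mu> w x u"
    and w: "\<And>t. n \<le> t \<Longrightarrow> w t = 0"
  shows "(\<Sum>t<n. stage (\<gamma>\<^sup>2) (x t) (u t) (w t)) \<le> 0"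
proof -
  define z where "z = (\<lambda>t. C *v x t + D *v u t)"
  have "sq_norm w = (\<Sum>t<n. ennreal (w t \<bullet> w t))"
    unfolding sq_norm_def by (rule suminf_finite) (auto simp: w)
  then have norm_w: "sq_norm w = ennreal (\<Sum>t<n. w t \<bullet> w t)"
    by (simp add: sum_nonneg)
  then have "w \<in> ell2"
    by (simp add: ell2_def)
  then have "sq_norm z \<le> ennreal (\<gamma>\<^sup>2) * sq_norm w"
    using ach cl unfolding achieves_def z_def by blast
  moreover have "(\<Sum>t<n. ennreal (z t \<bullet> z t)) \<le> sq_norm z"
    unfolding sq_norm_def by (rule sum_le_suminf) auto
  ultimately have "ennreal (\<Sum>t<n. z t \<bullet> z t) \<le> ennreal (\<gamma>\<^sup>2 * (\<Sum>t<n. w t \<bullet> w t))"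
    by (simp add: norm_w ennreal_mult' sum_nonneg)
  then have "(\<Sum>t<n. z t \<bullet> z t) \<le> \<gamma>\<^sup>2 * (\<Sum>t<n. w t \<bullet> w t)"
    by (subst (asm) ennreal_le_iff) (auto intro!: mult_nonneg_nonneg sum_nonneg)
  then show ?thesis
    by (simp add: stage_def z_def inner_orthogonal_output[OF orth] sum_subtractf sum_distrib_left)
qed

text \<open>Without disturbance the bound forces the output to vanish; so does the control,
  \<open>D\<close> being injective, and the state stays at 0.\<close>

lemma achieves_zero_history:
  assumes "achieves A B C D T \<mu> \<gamma>"
  shows "\<mu> t (info T (\<lambda>_. 0) t) = 0"
proof -
  obtain x u where cl: "closed_loop A B T \<mu> (\<lambda>_. 0) x u"
    by (rule closed_loop_exists)
  have u: "u t = 0" for t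
  proof -
    have "(\<Sum>t<Suc t. stage (\<gamma>\<^sup>2) (x t) (u t) 0) \<le> 0"
      by (rule achieves_stage_sum[OF assms cl]) simp
    moreover have "0 \<le> stage (\<gamma>\<^sup>2) (x t) (u t) 0" for t
      by (simp add: stage_def)
    ultimately have "stage (\<gamma>\<^sup>2) (x t) (u t) 0 = 0"
      by (metis (no_types, lifting) finite_lessThan lessThan_iff lessI order_antisym sum_nonneg
          sum_nonneg_eq_0_iff)
    then have "D *v u t = 0"
      by (simp add: stage_def add_nonneg_eq_0_iff)
    then show ?thesis
      using inj_D by (simp add: linear_injective_0[OF linear_D])
  qed
  have "x t = 0" for t
    using cl by (induction t) (simp_all add: closed_loop_def u)
  then have "x = (\<lambda>_. 0)"
    by auto
  then show ?thesis
    using cl u by (auto simp: closed_loop_def)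
qed

text \<open>Until the end of the interval the controller has only seen zeros and applies no control, so the
  disturbance can steer the state along \<open>e\<close>; afterwards it plays for the value \<open>v N\<close>.\<close>

lemma achieves_error_bound:
  assumes ach: "achieves A B C D T \<mu> \<gamma>" and T: "schedule T" and \<tau>: "\<tau> \<in> set T"
    and v: "lower_values g v N" and g: "\<gamma>\<^sup>2 \<le> g" and e: "e 0 = 0"
  shows "error_cost (\<gamma>\<^sup>2) e \<tau> + v N (e \<tau>) \<le> 0"
proof -
  obtain l where l: "sampling_time T (Suc l) = sampling_time T l + \<tau>"
    using \<tau> by (rule schedule_interval_occurs)
  define s where "s = sampling_time T l"
  \<comment> \<open>The delay keeps the state at 0 at every sample before time
    \<open>s + \<tau>\<close>.\<close>
  define E where "E = (\<lambda>t. e (t - s))"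
  have "\<exists>\<phi>. \<forall>i<N. \<forall>x u. v (Suc i) x \<le> stage g x u (\<phi> i x u) + v i (A *v x + B *v u + \<phi> i x u)"
    using v unfolding lower_values_def by metis
  then obtain \<phi> where \<phi>: "\<And>i x u. i < N \<Longrightarrow>
      v (Suc i) x \<le> stage g x u (\<phi> i x u) + v i (A *v x + B *v u + \<phi> i x u)"
    by blast
  \<comment> \<open>In the second phase \<open>s + \<tau> + N - Suc t\<close> stages remain after
    the one at time \<open>t\<close>; the final zeros make the support finite.\<close>
  define \<omega> where "\<omega> = (\<lambda>t x u. if t < s + \<tau> then E (Suc t) - A *v E t
      else if t < s + \<tau> + N then \<phi> (s + \<tau> + N - Suc t) x u else 0)"
  obtain x u where cl: "closed_loop A B T \<mu> (\<lambda>t. \<omega> t (x t) (u t)) x u"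
    by (rule closed_loop_exists)
  define w where "w = (\<lambda>t. \<omega> t (x t) (u t))"
  have x_Suc: "x (Suc t) = A *v x t + B *v u t + w t" for t
    using cl by (simp add: closed_loop_def w_def)
  have u_zero: "u t = 0" if "t < s + \<tau>" and past: "\<And>r. r \<le> t \<Longrightarrow> x r = E r" for t
  proof -
    have "info T x t = info T (\<lambda>_. 0) t"
    proof (rule info_cong)
      fix r assume "r \<le> t" "sampled T r"
      then have "r \<le> s"
        using sampled_before_next[OF T, of r l] l \<open>t < s + \<tau>\<close> by (simp add: s_def)
      then show "x r = 0"
        using past[OF \<open>r \<le> t\<close>] e by (simp add: E_def)
    qed
    then show ?thesis
      using cl achieves_zero_history[OF ach] by (simp add: closed_loop_def)
  qed
  have x_E: "x t = E t" if "t \<le> s + \<tau>" for t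
    using that
  proof (induction t rule: less_induct)
    case (less t)
    show ?case
    proof (cases t)
      case 0
      then show ?thesis
        using cl e by (simp add: closed_loop_def E_def)
    next
      case (Suc t')
      then have "u t' = 0"
        using less by (intro u_zero) auto
      then show ?thesis
        using less.IH[of t'] less.prems by (simp add: Suc x_Suc w_def \<omega>_def)
    qed
  qed
  have u: "u t = 0" if "t < s + \<tau>" for t
    using that x_E by (intro u_zero) auto
  define a where "a = s + \<tau>"
  have "(\<Sum>t<a. stage (\<gamma>\<^sup>2) (x t) (u t) (w t)) = error_cost (\<gamma>\<^sup>2) E a"
    unfolding error_cost_def a_def
    by (rule sum.cong) (auto simp: x_E u w_def \<omega>_def)
  then have first: "(\<Sum>t<a. stage (\<gamma>\<^sup>2) (x t) (u t) (w t)) = error_cost (\<gamma>\<^sup>2) e \<tau>"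
    unfolding E_def a_def by (simp add: error_cost_delay[of e, OF e])
  have second: "v N (x a) \<le> (\<Sum>t<j. stage g (x (a + t)) (u (a + t)) (w (a + t))) + v (N - j) (x (a + j))"
    if "j \<le> N" for j
    using that
  proof (induction j)
    case (Suc j)
    have w: "w (a + j) = \<phi> (N - Suc j) (x (a + j)) (u (a + j))"
      using Suc.prems by (simp add: w_def \<omega>_def a_def)
    have "v (N - j) (x (a + j)) \<le> stage g (x (a + j)) (u (a + j)) (w (a + j))
        + v (N - Suc j) (x (Suc (a + j)))"
      using \<phi>[of "N - Suc j" "x (a + j)" "u (a + j)"] Suc.prems
      by (simp add: x_Suc w[symmetric] Suc_diff_Suc)
    then show ?case
      using Suc by simp
  qed simp
  have "v N (x a) \<le> (\<Sum>t<N. stage g (x (a + t)) (u (a + t)) (w (a + t)))"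
    using second[of N] v by (simp add: lower_values_def)
  \<comment> \<open>\<open>v N\<close> is secured at level \<open>g\<close>; lowering the level to
    \<open>\<gamma>\<^sup>2\<close> only raises the payoff.\<close>
  also have "\<dots> \<le> (\<Sum>t<N. stage (\<gamma>\<^sup>2) (x (a + t)) (u (a + t)) (w (a + t)))"
    using g by (intro sum_mono) (simp add: stage_def mult_right_mono)
  finally have "error_cost (\<gamma>\<^sup>2) e \<tau> + v N (x a)
      \<le> (\<Sum>t<a + N. stage (\<gamma>\<^sup>2) (x t) (u t) (w t))"
    unfolding sum_lessThan_add first by simp
  also have "\<dots> \<le> 0"
    by (rule achieves_stage_sum[OF ach cl[folded w_def]]) (simp add: w_def \<omega>_def a_def)
  finally show ?thesis
    by (simp add: x_E a_def E_def)
qed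

text \<open>Over each interval the payoff is at most the decrease of \<open>b\<close> between the
  samples, so the sum telescopes from the initial state 0.\<close>

lemma achieves_open_loop:
  assumes b: "psd_form b" and ric: "riccati (\<gamma>\<^sup>2) b K W b"
    and error: "\<And>e. e 0 = 0 \<Longrightarrow> error_cost (\<gamma>\<^sup>2) e \<tau> + b (e \<tau>) (e \<tau>) \<le> 0"
    and T: "schedule T" "Max (set T) \<le> \<tau>"
  shows "\<exists>\<mu>. achieves A B C D T \<mu> \<gamma>"
proof -
  \<comment> \<open>\<open>F\<close> is the predicted motion under saddle point play, restarted at
    each sample; time 0 is a sample, so there is always a latest one.\<close>
  define F where "F = (\<lambda>x. A *v x + B *v K x + W x)"
  define latest where "latest = (\<lambda>t. Max {r. r \<le> t \<and> sampled T r})"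
  define \<mu> where "\<mu> = (\<lambda>t I. K ((F ^^ (t - latest t)) (the (I (latest t)))))"
  define s where "s = sampling_time T"
  have "strict_mono s"
    unfolding s_def by (rule sampling_time_strict_mono[OF T(1)])
  have latest: "latest t = s l" if "s l \<le> t" "t < s (Suc l)" for t l
    unfolding latest_def
  proof (rule Max_eqI)
    show "r \<le> s l" if "r \<in> {r. r \<le> t \<and> sampled T r}" for r
      using that \<open>t < s (Suc l)\<close> sampled_before_next[OF T(1), of r l] unfolding s_def by simp
  qed (use that in \<open>auto simp: s_def sampled_def\<close>)
  have "sq_norm (\<lambda>t. C *v x t + D *v u t) \<le> ennreal (\<gamma>\<^sup>2) * sq_norm w"
    if cl: "closed_loop A B T \<mu> w x u" for w x u
  proof -
    have x_Suc: "x (Suc t) = A *v x t + B *v u t + w t" for t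
      using cl by (simp add: closed_loop_def)
    have u: "u t = K ((F ^^ (t - s l)) (x (s l)))" if "s l \<le> t" "t < s (Suc l)" for t l
    proof -
      have "u t = \<mu> t (info T x t)"
        using cl by (simp add: closed_loop_def)
      then show ?thesis
        using that by (simp add: \<mu>_def latest[OF that] info_def sampled_def s_def)
    qed
    have stages: "(\<Sum>t<s l. stage (\<gamma>\<^sup>2) (x t) (u t) (w t)) + b (x (s l)) (x (s l)) \<le> 0" for l
    proof (induction l)
      case 0
      then show ?case
        using cl psd_formD(1)[OF b] by (simp add: s_def closed_loop_def bilinear_lzero)
    next
      case (Suc l)
      define k where "k = s (Suc l) - s l"
      have k: "s (Suc l) = s l + k"
        using \<open>strict_mono s\<close> by (simp add: k_def strict_mono_less_eq)
      have "k \<le> \<tau>"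
        using sampling_interval_le_Max[OF T(1), of l] T(2) unfolding k_def s_def by linarith
      have "(\<Sum>t<k. stage (\<gamma>\<^sup>2) (x (s l + t)) (u (s l + t)) (w (s l + t)))
          + b (x (s l + k)) (x (s l + k)) \<le> b (x (s l + 0)) (x (s l + 0))"
      proof (rule open_loop_bound[OF b ric])
        show "error_cost (\<gamma>\<^sup>2) e k + b (e k) (e k) \<le> 0" if "e 0 = 0" for e
          using error_bound_shorter[of "\<gamma>\<^sup>2" \<tau> "\<lambda>x. b x x"] error \<open>k \<le> \<tau>\<close> that by blast
        show "u (s l + t) = K (((\<lambda>x. A *v x + B *v K x + W x) ^^ t) (x (s l + 0)))" if "t < k" for t
          using u[of l "s l + t"] that by (simp add: k F_def)
      qed (simp add: x_Suc)
      then show ?case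
        unfolding k sum_lessThan_add using Suc by simp
    qed
    show ?thesis
      unfolding sq_norm_def
    proof (rule suminf_le_const)
      fix n
      define z where "z = (\<lambda>t. C *v x t + D *v u t)"
      \<comment> \<open>The payoff bound is available at sampling times only, so a partial sum up to
        \<open>n\<close> is extended to \<open>s n\<close>.\<close>
      have "n \<le> s n"
        using \<open>strict_mono s\<close> by (rule strict_mono_imp_increasing)
      then have "(\<Sum>t<n. z t \<bullet> z t) \<le> (\<Sum>t<s n. z t \<bullet> z t)"
        by (intro sum_mono2) auto
      also have "\<dots> = (\<Sum>t<s n. stage (\<gamma>\<^sup>2) (x t) (u t) (w t)) + \<gamma>\<^sup>2 * (\<Sum>t<s n. w t \<bullet> w t)"
        by (simp add: stage_def z_def inner_orthogonal_output[OF orth] sum_subtractf sum_distrib_left)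
      also have "\<dots> \<le> \<gamma>\<^sup>2 * (\<Sum>t<s n. w t \<bullet> w t)"
        using stages[of n] psd_formD(3)[OF b, of "x (s n)"] by simp
      finally have "(\<Sum>t<n. ennreal (z t \<bullet> z t)) \<le> ennreal (\<gamma>\<^sup>2) * (\<Sum>t<s n. ennreal (w t \<bullet> w t))"
        by (simp add: sum_nonneg flip: ennreal_mult')
      also have "\<dots> \<le> ennreal (\<gamma>\<^sup>2) * (\<Sum>t. ennreal (w t \<bullet> w t))"
        by (intro mult_left_mono sum_le_suminf) auto
      finally show "(\<Sum>t<n. ennreal ((C *v x t + D *v u t) \<bullet> (C *v x t + D *v u t)))
          \<le> ennreal (\<gamma>\<^sup>2) * (\<Sum>t. ennreal (w t \<bullet> w t))"
        by (simp add: z_def)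
    qed auto
  qed
  then show ?thesis
    unfolding achieves_def by blast
qed

text \<open>The slack between \<open>\<gamma>\<close> and \<open>\<gamma>'\<close> supplies the
  strict gap for solving the Riccati equation: lower values at the larger level are bounded by the
  smaller one.\<close>

lemma achieves_transfer:
  assumes ach: "achieves A B C D T \<mu> \<gamma>" and T: "schedule T" and \<gamma>: "0 < \<gamma>" "\<gamma> < \<gamma>'"
    and T': "schedule T'" "Max (set T') \<le> Max (set T)"
  shows "\<exists>\<mu>'. achieves A B C D T' \<mu>' \<gamma>'"
proof -
  define \<tau> where "\<tau> = Max (set T)"
  have \<tau>: "\<tau> \<in> set T"
    using T by (simp add: \<tau>_def schedule_def)
  then obtain k where k: "\<tau> = Suc k"
    using T by (metis schedule_def Suc_le_D One_nat_def)
  have less: "\<gamma>\<^sup>2 < \<gamma>'\<^sup>2"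
    using \<gamma> by (simp add: power_strict_mono)
  then have le: "\<gamma>\<^sup>2 \<le> \<gamma>'\<^sup>2"
    by simp
  have "v N y \<le> \<gamma>\<^sup>2 * (y \<bullet> y)" if v: "lower_values (\<gamma>'\<^sup>2) v N" for v N y
  proof -
    \<comment> \<open>An error jumping to \<open>y\<close> in the last step costs only that
      disturbance, so the error bound becomes a bound on the value at \<open>y\<close>. It starts at
      0 because \<open>\<tau>\<close> is positive.\<close>
    define e where "e = (\<lambda>t. if t = \<tau> then y else 0)"
    have "error_cost (\<gamma>\<^sup>2) e \<tau> + v N (e \<tau>) \<le> 0"
      by (rule achieves_error_bound[OF ach T \<tau> v le]) (simp add: e_def k)
    moreover have "error_cost (\<gamma>\<^sup>2) e \<tau> = - (\<gamma>\<^sup>2 * (y \<bullet> y))"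
      by (simp add: error_cost_def k e_def stage_def)
    ultimately show ?thesis
      by (simp add: e_def)
  qed
  then obtain b K W v where b: "psd_form b" "riccati (\<gamma>'\<^sup>2) b K W b"
    and v: "\<And>N. lower_values (\<gamma>'\<^sup>2) v N" and lim: "\<And>x. (\<lambda>i. v i x) \<longlonglongrightarrow> b x x"
    using riccati_fixed_point[of "\<gamma>'\<^sup>2" "\<gamma>\<^sup>2"] less by blast
  have "error_cost (\<gamma>'\<^sup>2) e \<tau> + b (e \<tau>) (e \<tau>) \<le> 0" if "e 0 = 0" for e
  proof -
    have "error_cost (\<gamma>\<^sup>2) e \<tau> + b (e \<tau>) (e \<tau>) \<le> 0"
      by (rule LIMSEQ_le_const2[OF tendsto_add[OF tendsto_const lim]])
        (use achieves_error_bound[where e = e, OF ach T \<tau> v le that] in blast)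
    then show ?thesis
      using error_cost_antimono[OF le, of e \<tau>] by simp
  qed
  then show ?thesis
    using achieves_open_loop[OF b _ T'(1)] T'(2) unfolding \<tau>_def by blast
qed

text \<open>The infimum absorbs the slack of the transfer. Applied both ways, this equates the
  bounds of schedules with equal largest interval.\<close>

lemma gamma_mono:
  assumes "schedule T" "schedule T'" "Max (set T') \<le> Max (set T)"
  shows "gamma A B C D T' \<le> gamma A B C D T"
  unfolding gamma_def[of A B C D T]
proof (rule Inf_greatest, clarify)
  fix \<gamma> \<mu> assume "0 < \<gamma>" "achieves A B C D T \<mu> \<gamma>"
  show "gamma A B C D T' \<le> ennreal \<gamma>"
  proof (rule ennreal_le_epsilon)
    fix \<epsilon> :: real assume "0 < \<epsilon>"
    then have "\<exists>\<mu>'. achieves A B C D T' \<mu>' (\<gamma> + \<epsilon>)"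
      using achieves_transfer[OF \<open>achieves A B C D T \<mu> \<gamma>\<close>] assms \<open>0 < \<gamma>\<close> by simp
    then have "gamma A B C D T' \<le> ennreal (\<gamma> + \<epsilon>)"
      unfolding gamma_def using \<open>0 < \<gamma>\<close> \<open>0 < \<epsilon>\<close> by (intro Inf_lower CollectI exI[of _ "\<gamma> + \<epsilon>"]) auto
    then show "gamma A B C D T' \<le> ennreal \<gamma> + ennreal \<epsilon>"
      using \<open>0 < \<gamma>\<close> \<open>0 < \<epsilon>\<close> by simp
  qed
qed

end

section \<open>Average intervals\<close>

lemma avg_interval_sum_list: "avg_interval T = real (sum_list T) / real (length T)"
  by (simp add: avg_interval_def sum_list_sum_nth atLeast0LessThan)

lemma avg_interval_le_Max:
  assumes "schedule T"
  shows "avg_interval T \<le> real (Max (set T))"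
  unfolding avg_interval_def
proof -
  have "(\<Sum>l<length T. real (T ! l)) \<le> real (length T) * real (Max (set T))"
    by (rule order_trans[OF sum_bounded_above[of _ _ "real (Max (set T))"]]) auto
  then show "(\<Sum>l<length T. real (T ! l)) / real (length T) \<le> real (Max (set T))"
    using assms by (simp add: schedule_def field_simps)
qed

text \<open>The deficits \<open>M - T ! l\<close> are nonnegative, and the average forces their sum
  to be at most 0.\<close>

lemma avg_interval_eq_bound:
  assumes "schedule T" and le: "\<And>\<tau>. \<tau> \<in> set T \<Longrightarrow> \<tau> \<le> M" and avg: "real M \<le> avg_interval T"
  shows "evenly_spaced M T"
  unfolding evenly_spaced_def
proof (intro conjI ballI)
  fix \<tau> assume "\<tau> \<in> set T"
  then obtain i where i: "i < length T" "T ! i = \<tau>"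
    by (auto simp: in_set_conv_nth)
  have "(\<Sum>l<length T. real M - real (T ! l)) \<le> 0"
    using avg assms(1) by (simp add: avg_interval_def schedule_def field_simps sum_subtractf)
  moreover have "real M - real (T ! i) \<le> (\<Sum>l<length T. real M - real (T ! l))"
    using i le by (intro member_le_sum) auto
  ultimately show "\<tau> = M"
    using le[OF \<open>\<tau> \<in> set T\<close>] i by simp
qed (fact assms(1))

lemma avg_interval_evenly_spaced:
  assumes "evenly_spaced M T"
  shows "avg_interval T = real M"
proof -
  have "T ! l = M" if "l < length T" for l
    using assms that by (simp add: evenly_spaced_def)
  then have "(\<Sum>l<length T. real (T ! l)) = real (length T) * real M"
    by simp
  then show ?thesis
    using assms by (simp add: avg_interval_def evenly_spaced_def schedule_def)
qed

lemma avg_interval_pos: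
  assumes "schedule T"
  shows "0 < avg_interval T"
  unfolding avg_interval_def using assms
  by (intro divide_pos_pos sum_pos) (auto simp: schedule_def Suc_le_eq)

text \<open>Division with remainder spreads \<open>h\<close> over \<open>m\<close> intervals of
  length \<open>h div m\<close> or one more. The longer ones occur only for a nonzero remainder,
  hence the strict bound.\<close>

lemma balanced_schedule_exists:
  assumes "1 \<le> m" "m \<le> h"
  obtains T where "schedule T" "avg_interval T = real h / real m"
    "real (Max (set T)) < real h / real m + 1"
proof -
  define q r where "q = h div m" and "r = h mod m"
  have h: "h = m * q + r" "r < m" "1 \<le> q"
    using assms by (auto simp: q_def r_def div_greater_zero_iff Suc_le_eq)
  define T where "T = replicate r (Suc q) @ replicate (m - r) q"
  have "schedule T"
    using h by (auto simp: schedule_def T_def)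
  moreover have "avg_interval T = real h / real m"
    using h by (simp add: avg_interval_sum_list T_def sum_list_replicate algebra_simps)
  moreover have "real \<tau> < real h / real m + 1" if "\<tau> \<in> set T" for \<tau>
  proof -
    have "\<tau> * m < h + m"
      using that h by (auto simp: T_def algebra_simps)
    then have "real (\<tau> * m) < real (h + m)"
      by (simp only: of_nat_less_iff)
    then show ?thesis
      using assms by (simp add: field_simps)
  qed
  ultimately show ?thesis
    using that[of T] Max_in[of "set T"] by (auto simp: schedule_def)
qed


section \<open>Optimal schedules\<close>

theorem corollary3:
  fixes A :: "real^'n^'n" and B :: "real^'u^'n"
    and C\<^sub>2 :: "real^'n^'z" and D\<^sub>2\<^sub>1 :: "real^'u^'z"
    and h m h' :: nat
  assumes "transpose C\<^sub>2 ** D\<^sub>2\<^sub>1 = 0"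
    and "pos_definite (transpose D\<^sub>2\<^sub>1 ** D\<^sub>2\<^sub>1)"
    and "controllable A B"
    and "observable A C\<^sub>2"
    and "1 \<le> m" and "m \<le> h"
    and "h' = nat \<lceil>real h / real m\<rceil>"
  defines "g \<equiv> best_bound A B C\<^sub>2 D\<^sub>2\<^sub>1 (real h / real m)"
    and "gap \<equiv> (h' \<noteq> 1 \<longrightarrow> gamma_even A B C\<^sub>2 D\<^sub>2\<^sub>1 (h' - 1) < gamma_even A B C\<^sub>2 D\<^sub>2\<^sub>1 h') \<and>
                gamma_even A B C\<^sub>2 D\<^sub>2\<^sub>1 h' < gamma_even A B C\<^sub>2 D\<^sub>2\<^sub>1 (h' + 1)"
  shows "(\<forall>T. schedule T \<and> avg_interval T = real h / real m \<and> Max (set T) \<le> h' \<longrightarrow>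
              guarantees A B C\<^sub>2 D\<^sub>2\<^sub>1 T g) \<and>
         (gap \<longrightarrow>
            (\<forall>T. schedule T \<and> avg_interval T = real h / real m \<and> guarantees A B C\<^sub>2 D\<^sub>2\<^sub>1 T g \<longrightarrow>
                 Max (set T) \<le> h')) \<and>
         (gap \<longrightarrow>
            (\<forall>T. is_arg_min avg_rate (\<lambda>T. schedule T \<and> guarantees A B C\<^sub>2 D\<^sub>2\<^sub>1 T g) T \<longleftrightarrow>
                 evenly_spaced h' T))"
proof -
  let ?G = "gamma A B C\<^sub>2 D\<^sub>2\<^sub>1"
  note mono = gamma_mono[OF assms(1,2), of _ _ A B]
  have h'_le_iff: "h' \<le> k \<longleftrightarrow> real h / real m \<le> real k" for k
    using assms(7) by (simp add: nat_le_iff ceiling_le_iff)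
  have "1 \<le> real h / real m"
    using assms(5,6) by simp
  then have "1 \<le> h'"
    using h'_le_iff[of h'] by simp
  then have single: "schedule [k]" if "h' \<le> k" for k
    using that by (simp add: schedule_def)
  have h'_le_Max: "h' \<le> Max (set T)" if "schedule T" "avg_interval T = real h / real m" for T
    using avg_interval_le_Max[OF that(1)] that(2) by (simp add: h'_le_iff)
  obtain T\<^sub>0 where T\<^sub>0: "schedule T\<^sub>0" "avg_interval T\<^sub>0 = real h / real m"
    and "real (Max (set T\<^sub>0)) < real h / real m + 1"
    using balanced_schedule_exists[OF assms(5,6)] by blast
  then have Max_T\<^sub>0: "Max (set T\<^sub>0) \<le> h'"
    using h'_le_iff[of h'] by linarith
  \<comment> \<open>Even spacing \<open>h'\<close> need not have average \<open>h / m\<close>, but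
    its bound is the infimum: the balanced schedule does no worse, and every competitor has an
    interval of at least \<open>h'\<close>.\<close>
  have g: "g = ?G [h']"
  proof (rule antisym)
    have "g \<le> ?G T\<^sub>0"
      unfolding g_def best_bound_def by (rule INF_lower) (simp add: T\<^sub>0)
    also have "\<dots> \<le> ?G [h']"
      using T\<^sub>0 Max_T\<^sub>0 single by (intro mono) auto
    finally show "g \<le> ?G [h']" .
    show "?G [h'] \<le> g"
      unfolding g_def best_bound_def using h'_le_Max single by (auto intro!: INF_greatest mono)
  qed
  have short: "guarantees A B C\<^sub>2 D\<^sub>2\<^sub>1 T g" if "schedule T" "Max (set T) \<le> h'" for T
    unfolding guarantees_def g using that single by (intro mono) auto
  \<comment> \<open>An interval above \<open>h'\<close> does no better than even spacing
    \<open>h' + 1\<close>. The average is left free because the rate claim ranges over all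
    schedules.\<close>
  have only: "Max (set T) \<le> h'" if gap "schedule T" "guarantees A B C\<^sub>2 D\<^sub>2\<^sub>1 T g" for T
  proof (rule ccontr)
    assume "\<not> Max (set T) \<le> h'"
    then have "?G [h' + 1] \<le> ?G T"
      using that single by (intro mono) auto
    also have "\<dots> \<le> ?G [h']"
      using that by (simp add: guarantees_def g)
    finally show False
      using that(1) by (auto simp: gap_def gamma_even_def dest: leD)
  qed
  \<comment> \<open>Smallest rate means largest average interval; by \<open>only\<close> this is at
    most \<open>h'\<close>, with equality just for even spacing.\<close>
  have "is_arg_min avg_rate (\<lambda>T. schedule T \<and> guarantees A B C\<^sub>2 D\<^sub>2\<^sub>1 T g) T \<longleftrightarrow> evenly_spaced h' T"
    if gap for T
  proof
    assume min: "is_arg_min avg_rate (\<lambda>T. schedule T \<and> guarantees A B C\<^sub>2 D\<^sub>2\<^sub>1 T g) T"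
    then have T: "schedule T" "Max (set T) \<le> h'"
      using only[OF that] by (auto simp: is_arg_min_def)
    have "\<not> avg_rate [h'] < avg_rate T"
      using min single[of h'] short[of "[h']"] by (auto simp: is_arg_min_def)
    then have "real h' \<le> avg_interval T"
      using avg_interval_pos[OF T(1)] \<open>1 \<le> h'\<close>
      by (simp add: avg_rate_def avg_interval_def[of "[h']"] field_simps)
    then show "evenly_spaced h' T"
      using T by (intro avg_interval_eq_bound) (auto intro: order_trans[OF Max_ge])
  next
    assume T: "evenly_spaced h' T"
    then have "schedule T" "Max (set T) \<le> h'"
      by (auto simp: evenly_spaced_def schedule_def)
    moreover have "\<not> avg_rate T' < avg_rate T"
      if "schedule T'" "guarantees A B C\<^sub>2 D\<^sub>2\<^sub>1 T' g" for T'
    proof -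
      have "avg_interval T' \<le> real h'"
        using avg_interval_le_Max[OF that(1)] only[OF \<open>gap\<close> that] by linarith
      then show ?thesis
        using avg_interval_pos[OF that(1)]
        by (simp add: avg_rate_def avg_interval_evenly_spaced[OF T] field_simps)
    qed
    ultimately show "is_arg_min avg_rate (\<lambda>T. schedule T \<and> guarantees A B C\<^sub>2 D\<^sub>2\<^sub>1 T g) T"
      using short by (auto simp: is_arg_min_def)
  qed
  then show ?thesis
    using short only by blast
qed

end
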